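(* Let $R$ be a finite rng with $R^2=R$. Then $R$ is generated as a two-sided ideal by the set of its idempotents, and $w(R)=1$.
   Context: A rng is an associative ring that is not required to have a multiplicative unit. For a rng $R$, $R^2$ denotes the additive subgroup generated by $\{xy : x,y\in R\}$; a rng with $R^2=R$ is called an irng. For a subset $Z$ of a rng $R$, the two-sided ideal generated by $Z$ is the additive subgroup of $R$ generated by $Z\cup RZ\cup ZR\cup RZR$. The weight $w(R)$ of a rng $R$ is the minimum of the positive integers $n$ such that $R$ is generated by $n$ elements as a two-sided ideal; so $w(R)=1$ means that $R$ is generated as a two-sided ideal by a single element (the zero rng has weight $1$ under this convention). *)

theory Defs
  imports
    Main
    "HOL-Library.Extended_Nat"
    "HOL-Computational_Algebra.Group_Closure"
begin

text \<open>
  The type class \<open>ring\<close> has no multiplicative unit: its models are exactly the rngs.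
\<close>

definition rng_square :: "'a::ring set" where
  "rng_square = group_closure {x * y | x y. True}"

definition rng_ideal :: "'a::ring set \<Rightarrow> 'a set" where
  "rng_ideal Z = group_closure
     (Z \<union> {r * z | r z. z \<in> Z} \<union> {z * s | z s. z \<in> Z} \<union> {r * z * s | r z s. z \<in> Z})"

definition idempotents :: "'a::ring set" where
  "idempotents = {e. e * e = e}"

text \<open>
  The weight of the rng \<open>'a\<close>: the minimum over the positive \<open>n\<close> only, so that the zero rng
  has weight \<open>1\<close>. The infimum in \<open>enat\<close> of the empty set is \<open>\<infinity>\<close>, so
  the weight is \<open>\<infinity>\<close> when \<open>'a\<close> is not finitely generated as an ideal.
\<close>

definition weight :: "'a::ring itself \<Rightarrow> enat" where
  "weight _ = Inf {enat n | n. n > 0 \<and>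
     (\<exists>Z :: 'a set. finite Z \<and> card Z = n \<and> rng_ideal Z = UNIV)}"

end

theory Submission
  imports Defs
begin

text \<open>
  Everything rests on one fact about semigroups: a non-empty finite set closed under an
  associative multiplication contains an idempotent. Applied to the set of right
  stabilizers of \<open>p\<close>, it shows that \<open>p = p * t\<close> forces \<open>p = p * e\<close> with \<open>e\<close> idempotent, so
  that \<open>p\<close> lies in the ideal \<open>I\<close> generated by the idempotents.

  Consequently, an element outside \<open>I\<close> is never a right multiple of itself, and right
  divisibility is a strict, hence well-founded, order on the finite complement of \<open>I\<close>.
  If \<open>R\<^sup>2 = R\<close>, well-founded induction gives \<open>p R \<subseteq> I\<close> for every \<open>p\<close>: expanding
  \<open>r = \<Sum> c d\<close> turns \<open>p r\<close> into \<open>\<Sum> (p c) d\<close>, in which each \<open>p c\<close> is in \<open>I\<close> or strictly below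
  \<open>p\<close>. Hence \<open>R = R\<^sup>2 \<subseteq> I\<close>. (This is the elementary core of the argument that \<open>R / I\<close> is a
  finite nil rng, hence nilpotent, and being equal to its square it vanishes.)

  For the weight, two idempotents \<open>e\<close> and \<open>f\<close> lie in the ideal of a single idempotent \<open>g\<close>:
  the element \<open>z = e + f - e f\<close> satisfies \<open>e z = e\<close> and \<open>z f = f\<close>, and the solutions of
  these two equations form a semigroup, from which an idempotent solution \<open>g\<close> can be taken.
  By induction the finitely many idempotents of \<open>R\<close> lie in the ideal of a single one, and
  that ideal is all of \<open>R\<close>.
\<close>

section \<open>Ideals generated by a set\<close>

lemma rng_ideal_generator: "z \<in> Z \<Longrightarrow> z \<in> rng_ideal Z"
  unfolding rng_ideal_def by (intro group_closure.base) auto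

lemma rng_ideal_zero: "0 \<in> rng_ideal Z"
  unfolding rng_ideal_def by simp

lemma rng_ideal_diff: "x \<in> rng_ideal Z \<Longrightarrow> y \<in> rng_ideal Z \<Longrightarrow> x - y \<in> rng_ideal Z"
  unfolding rng_ideal_def by (rule group_closure.diff)

lemma rng_ideal_mult_left:
  fixes a :: "'a::ring"
  assumes "x \<in> rng_ideal Z"
  shows "a * x \<in> rng_ideal Z"
  using assms unfolding rng_ideal_def
proof (induction x rule: group_closure.induct)
  case (base s)
  then consider (zero) "s = 0" | (gen) "s \<in> Z" | (left) r z where "z \<in> Z" "s = r * z"
    | (right) t z where "z \<in> Z" "s = z * t" | (both) r z t where "z \<in> Z" "s = r * z * t"
    by blast
  then show ?case
  proof cases
    case (left r z)
    then have "a * s = (a * r) * z"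
      by (simp add: mult.assoc)
    with left show ?thesis
      by (intro group_closure.base) blast
  next
    case (right t z)
    then have "a * s = a * z * t"
      by (simp add: mult.assoc)
    with right show ?thesis
      by (intro group_closure.base) blast
  next
    case (both r z t)
    then have "a * s = (a * r) * z * t"
      by (simp add: mult.assoc)
    with both show ?thesis
      by (intro group_closure.base) blast
  qed (simp, intro group_closure.base, blast)
qed (auto simp: right_diff_distrib intro: group_closure.diff)

lemma rng_ideal_mult_right:
  fixes a :: "'a::ring"
  assumes "x \<in> rng_ideal Z"
  shows "x * a \<in> rng_ideal Z"
  using assms unfolding rng_ideal_def
proof (induction x rule: group_closure.induct)
  case (base s)
  then consider (zero) "s = 0" | (gen) "s \<in> Z" | (left) r z where "z \<in> Z" "s = r * z"
    | (right) t z where "z \<in> Z" "s = z * t" | (both) r z t where "z \<in> Z" "s = r * z * t"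
    by blast
  then show ?case
  proof cases
    case (right t z)
    then have "s * a = z * (t * a)"
      by (simp add: mult.assoc)
    with right show ?thesis
      by (intro group_closure.base) blast
  next
    case (both r z t)
    then have "s * a = r * z * (t * a)"
      by (simp add: mult.assoc)
    with both show ?thesis
      by (intro group_closure.base) blast
  qed (simp, (intro group_closure.base, blast)+)
qed (auto simp: left_diff_distrib intro: group_closure.diff)

lemma rng_ideal_least:
  assumes "Z \<subseteq> rng_ideal W"
  shows "rng_ideal Z \<subseteq> rng_ideal W"
proof
  fix x
  assume "x \<in> rng_ideal Z"
  then show "x \<in> rng_ideal W"
    unfolding rng_ideal_def [of Z]
    using assms
    by (induction x rule: group_closure.induct)
      (auto intro: rng_ideal_zero rng_ideal_diff rng_ideal_mult_left rng_ideal_mult_right)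
qed

section \<open>Idempotents in finite semigroups\<close>

text \<open>
  It suffices to treat an \<open>S\<close> without smaller subsemigroups. For \<open>x \<in> S\<close>, the subsemigroup
  \<open>x S\<close> is then \<open>S\<close>, so \<open>x y = x\<close> for some \<open>y \<in> S\<close>. All such \<open>y\<close> form a subsemigroup as
  well, which is again \<open>S\<close>. Hence it contains \<open>x\<close>, that is, \<open>x x = x\<close>.
\<close>

lemma finite_semigroup_has_idempotent:
  fixes S :: "'a::semigroup_mult set"
  assumes "finite S" "S \<noteq> {}" "\<And>x y. x \<in> S \<Longrightarrow> y \<in> S \<Longrightarrow> x * y \<in> S"
  obtains e where "e \<in> S" "e * e = e"
proof -
  have "\<exists>e\<in>S. e * e = e"
    using assms
  proof (induction S rule: finite_psubset_induct)
    case (psubset S)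
    from psubset.prems obtain x where x: "x \<in> S"
      by blast
    define xS where "xS = (*) x ` S"
    define stab where "stab = {y \<in> S. x * y = x}"
    have xS: "xS \<subseteq> S" "xS \<noteq> {}" "\<And>u v. u \<in> xS \<Longrightarrow> v \<in> xS \<Longrightarrow> u * v \<in> xS"
      unfolding xS_def using psubset.prems x by (auto simp: mult.assoc)
    have stab: "stab \<subseteq> S" "\<And>u v. u \<in> stab \<Longrightarrow> v \<in> stab \<Longrightarrow> u * v \<in> stab"
      unfolding stab_def using psubset.prems by (auto simp flip: mult.assoc)
    show ?case
    proof (cases "xS = S \<and> stab = S")
      case True
      with x show ?thesis
        unfolding stab_def by blast
    next
      case False
      have "stab \<noteq> {}" if "xS = S"
      proof -
        from that x obtain y where "y \<in> S" "x = x * y"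
          unfolding xS_def by blast
        then show ?thesis
          unfolding stab_def by force
      qed
      with False xS stab psubset.IH show ?thesis
        by (metis psubsetI subsetD)
    qed
  qed
  with that show thesis
    by blast
qed

section \<open>The ideal generated by the idempotents\<close>

lemma right_stabilized_in_idempotent_ideal:
  fixes p t :: "'a::ring"
  assumes "finite (UNIV :: 'a set)" "p * t = p"
  shows "p \<in> rng_ideal idempotents"
proof -
  obtain e where "p * e = p" "e * e = e"
  proof (rule finite_semigroup_has_idempotent [of "{u. p * u = p}"])
    show "finite {u. p * u = p}"
      using assms(1) by (rule finite_subset [OF subset_UNIV])
    show "{u. p * u = p} \<noteq> {}"
      using assms(2) by blast
  qed (auto simp flip: mult.assoc)
  then have "p * e \<in> rng_ideal idempotents"
    by (intro rng_ideal_mult_left rng_ideal_generator) (simp add: idempotents_def)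
  with \<open>p * e = p\<close> show ?thesis
    by simp
qed

text \<open>
  The element \<open>r\<close> may be split as a sum of products, and this moves one factor at a time from
  \<open>r\<close> to \<open>p\<close>. The process stops because outside the ideal these steps strictly descend.
\<close>

lemma mult_in_idempotent_ideal:
  fixes p r :: "'a::ring"
  assumes fin: "finite (UNIV :: 'a set)" and sq: "(rng_square :: 'a set) = UNIV"
  shows "p * r \<in> rng_ideal idempotents"
proof -
  let ?I = "rng_ideal idempotents :: 'a set"
  \<comment> \<open>If \<open>q = p t\<close> is outside the ideal, so is \<open>p\<close>; thus only \<open>q\<close> has to be constrained.\<close>
  define below where "below = {(q, p). q \<notin> ?I \<and> (\<exists>t. q = p * t)}"
  have "trans below"
    unfolding below_def by (auto intro!: transI simp: mult.assoc)
  moreover have "irrefl below"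
    unfolding below_def
    by (auto intro!: irreflI dest: sym right_stabilized_in_idempotent_ideal [OF fin])
  ultimately have "acyclic below"
    by (simp add: acyclic_irrefl)
  moreover have "finite below"
    using fin by (meson finite_Prod_UNIV finite_subset subset_UNIV)
  ultimately have "wf below"
    by (intro finite_acyclic_wf)
  then show ?thesis
  proof (induction p arbitrary: r rule: wf_induct_rule)
    case (less p)
    have product: "p * (c * d) \<in> ?I" for c d
    proof (cases "p * c \<in> ?I")
      case True
      then show ?thesis
        by (simp add: rng_ideal_mult_right flip: mult.assoc)
    next
      case False
      then have "(p * c, p) \<in> below"
        unfolding below_def by blast
      then show ?thesis
        using less.IH by (simp flip: mult.assoc)
    qed
    have "r \<in> group_closure {c * d | c d. True}"
      using sq unfolding rng_square_def by blast
    then show ?case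
      by (induction r rule: group_closure.induct)
        (auto simp: right_diff_distrib product intro: rng_ideal_zero rng_ideal_diff)
  qed
qed

lemma idempotent_ideal_eq_UNIV:
  assumes "finite (UNIV :: 'a::ring set)" "(rng_square :: 'a set) = UNIV"
  shows "rng_ideal (idempotents :: 'a set) = UNIV"
proof -
  have "x \<in> rng_ideal idempotents" for x :: 'a
  proof -
    have "x \<in> group_closure {c * d | c d. True}"
      using assms(2) unfolding rng_square_def by blast
    then show ?thesis
      by (induction x rule: group_closure.induct)
        (auto intro: rng_ideal_zero rng_ideal_diff mult_in_idempotent_ideal [OF assms])
  qed
  then show ?thesis
    by blast
qed

section \<open>A single idempotent generator\<close>

text \<open>
  If \<open>e g = e\<close> and \<open>g f = f\<close>, the ideal of \<open>g\<close> contains \<open>e\<close> and \<open>f\<close>. The two conditions act on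
  opposite sides of \<open>g\<close>; this is why they are compatible although \<open>e\<close> and \<open>f\<close> need not commute.
  Making \<open>g\<close> idempotent allows the step to be repeated with a third idempotent.
\<close>

lemma two_idempotents_in_principal_ideal:
  fixes e f :: "'a::ring"
  assumes fin: "finite (UNIV :: 'a set)" and e: "e * e = e" and f: "f * f = f"
  obtains g where "g * g = g" "e \<in> rng_ideal {g}" "f \<in> rng_ideal {g}"
proof -
  let ?T = "{t. e * t = e \<and> t * f = f}"
  obtain g where g: "e * g = e" "g * f = f" "g * g = g"
  proof (rule finite_semigroup_has_idempotent [of ?T])
    show "finite ?T"
      using fin by (rule finite_subset [OF subset_UNIV])
    have "e * (e + f - e * f) = e"
      by (simp add: algebra_simps e flip: mult.assoc)
    moreover have "(e + f - e * f) * f = f"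
      by (simp add: algebra_simps f)
    ultimately show "?T \<noteq> {}"
      by blast
  next
    fix u v
    assume "u \<in> ?T" "v \<in> ?T"
    then have "e * u * v = e" "u * (v * f) = f"
      by simp_all
    then show "u * v \<in> ?T"
      by (simp add: mult.assoc)
  qed auto
  have "e * g \<in> rng_ideal {g}" "g * f \<in> rng_ideal {g}"
    by (simp_all add: rng_ideal_mult_left rng_ideal_mult_right rng_ideal_generator)
  with g show thesis
    using that by simp
qed

lemma finitely_many_idempotents_in_principal_ideal:
  fixes E :: "'a::ring set"
  assumes fin: "finite (UNIV :: 'a set)" and "finite E" "E \<subseteq> idempotents"
  obtains g where "g * g = g" "E \<subseteq> rng_ideal {g}"
proof -
  from \<open>finite E\<close> \<open>E \<subseteq> idempotents\<close> have "\<exists>g. g * g = g \<and> E \<subseteq> rng_ideal {g}"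
  proof (induction E rule: finite_induct)
    case empty
    have "(0::'a) * 0 = 0"
      by simp
    then show ?case
      by blast
  next
    case (insert e E)
    then obtain f where f: "f * f = f" "E \<subseteq> rng_ideal {f}"
      by auto
    from insert.prems have "e * e = e"
      by (simp add: idempotents_def)
    from two_idempotents_in_principal_ideal [OF fin this f(1)]
    obtain g where "g * g = g" "e \<in> rng_ideal {g}" "f \<in> rng_ideal {g}" .
    moreover from this have "rng_ideal {f} \<subseteq> rng_ideal {g}"
      by (simp add: rng_ideal_least)
    ultimately show ?case
      using f by blast
  qed
  with that show thesis
    by blast
qed

lemma weight_eq_1I:
  assumes "rng_ideal {g :: 'a::ring} = UNIV"
  shows "weight TYPE('a) = 1"
  unfolding weight_def
proof (rule antisym)
  let ?W = "{enat n | n. n > 0 \<and> (\<exists>Z :: 'a set. finite Z \<and> card Z = n \<and> rng_ideal Z = UNIV)}"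
  have "finite {g}" "card {g} = 1"
    by simp_all
  with assms have "enat 1 \<in> ?W"
    by (metis (mono_tags, lifting) mem_Collect_eq zero_less_one)
  then show "Inf ?W \<le> 1"
    unfolding one_enat_def by (rule Inf_lower)
  show "1 \<le> Inf ?W"
    by (rule Inf_greatest) (auto simp: one_enat_def)
qed

theorem corollary4:
  assumes "finite (UNIV :: 'a::ring set)"
    and "(rng_square :: 'a set) = UNIV"
  shows "rng_ideal (idempotents :: 'a set) = UNIV \<and> weight TYPE('a) = 1"
proof
  show generated: "rng_ideal (idempotents :: 'a set) = UNIV"
    using assms by (rule idempotent_ideal_eq_UNIV)
  have "finite (idempotents :: 'a set)"
    using assms(1) by (rule finite_subset [OF subset_UNIV])
  then obtain g :: 'a where "idempotents \<subseteq> rng_ideal {g}"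
    by (rule finitely_many_idempotents_in_principal_ideal [OF assms(1) _ subset_refl])
  then have "rng_ideal idempotents \<subseteq> rng_ideal {g}"
    by (rule rng_ideal_least)
  with generated show "weight TYPE('a) = 1"
    by (intro weight_eq_1I) blast
qed

end
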